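(* Let $d\ge 1$ and let $\Delta$ be a pure $d$-dimensional simplicial complex with facets $\sigma_1,\dots,\sigma_s$ and with $r$ ridges ($(d-1)$-faces). Let $F_i=\partial_d\sigma_i\in\mathbb{Z}^r$ denote the $i$-th column of the top boundary matrix $\partial_d$, and identify $\sigma_j$ with the $j$-th standard basis vector of $\mathbb{R}^s$. Then: (i) For every labeling $\ell=(\ell_1,\dots,\ell_s)\in[-1,1]^s$ with $\sum_{j=1}^s \ell_j\sigma_j\in \operatorname{im}_{\mathbb{R}}\partial_d^\top$ and $\max_j|\ell_j|=1$, and every $\mathbf{w}\in\mathbb{R}^r$ with $\partial_d^\top\mathbf{w}=\sum_{j=1}^s\ell_j\sigma_j$, the hyperplane $\{\mathbf{x}\in\mathbb{R}^r:\mathbf{w}^\top\mathbf{x}=1\}$ is a supporting hyperplane of $\mathcal{P}_\Delta$ with $\mathcal{P}_\Delta\subseteq\{\mathbf{x}:\mathbf{w}^\top\mathbf{x}\le 1\}$, and the corresponding face is $\mathcal{P}_\Delta\cap\{\mathbf{x}:\mathbf{w}^\top\mathbf{x}=1\}=\operatorname{conv}\{\ell_iF_i:|\ell_i|=1\}$. (ii) Conversely, every nonempty proper face of $\mathcal{P}_\Delta$ is of the form $\operatorname{conv}\{\ell_iF_i:|\ell_i|=1\}$ for some labeling $\ell\in[-1,1]^s$ with $\sum_j\ell_j\sigma_j\in\operatorname{im}_{\mathbb{R}}\partial_d^\top$ and $\max_j|\ell_j|=1$.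
   Context: For a simplicial complex $\Delta$ on vertex set $[n]$ and $j\ge1$, $C_j(\Delta)$ is the free module with basis the $j$-dimensional faces, and the boundary map $\partial_j:C_j\to C_{j-1}$ is $\partial_j(\{i_1<\dots<i_{j+1}\})=\sum_{k=1}^{j+1}(-1)^{k+1}(\sigma\setminus\{i_k\})$; $\partial_j$ also denotes its matrix in the standard bases (rows indexed by $(j-1)$-faces, columns by $j$-faces). For a $d$-dimensional complex $\Delta$, the symmetric homology polytope is $\mathcal{P}_\Delta=\operatorname{conv}$ of the columns of $\partial_d$ and of $-\partial_d$. $\operatorname{im}_{\mathbb{R}}$ denotes the real column span. *)

theory Defs
  imports "HOL-Analysis.Analysis" "HOL-Library.Poly_Mapping"
begin

text \<open>The vertex set of the complex is \<open>{1..n}\<close>; as usual every vertex is itself a face, and the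
  empty set is a face, of dimension \<open>-1\<close>. (HOL-Analysis has only geometric simplicial complexes.)\<close>

definition abstract_simplicial_complex :: "nat \<Rightarrow> nat set set \<Rightarrow> bool" where
  "abstract_simplicial_complex n \<Delta> \<longleftrightarrow>
     \<Delta> \<subseteq> Pow {1..n} \<and> {} \<in> \<Delta> \<and> (\<forall>v\<in>{1..n}. {v} \<in> \<Delta>) \<and>
     (\<forall>\<sigma>\<in>\<Delta>. \<forall>\<tau>. \<tau> \<subseteq> \<sigma> \<longrightarrow> \<tau> \<in> \<Delta>)"

definition simplex_dim :: "nat set \<Rightarrow> int" where
  "simplex_dim \<sigma> = int (card \<sigma>) - 1"

definition complex_dim :: "nat set set \<Rightarrow> int" where
  "complex_dim \<Delta> = Max (simplex_dim ` \<Delta>)"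

definition faces_of_dim :: "nat set set \<Rightarrow> int \<Rightarrow> nat set set" where
  "faces_of_dim \<Delta> j = {\<sigma> \<in> \<Delta>. simplex_dim \<sigma> = j}"

definition complex_facets :: "nat set set \<Rightarrow> nat set set" where
  "complex_facets \<Delta> = {\<sigma> \<in> \<Delta>. \<forall>\<tau>\<in>\<Delta>. \<sigma> \<subseteq> \<tau> \<longrightarrow> \<tau> = \<sigma>}"

definition pure_complex :: "nat set set \<Rightarrow> bool" where
  "pure_complex \<Delta> \<longleftrightarrow> (\<forall>\<sigma>\<in>complex_facets \<Delta>. simplex_dim \<sigma> = complex_dim \<Delta>)"

text \<open>Chains are formal integer combinations of simplices; \<open>sorted_list_of_set \<sigma> ! (k - 1)\<close> is
  the \<open>k\<close>-th smallest vertex \<open>i\<^sub>k\<close> of \<open>\<sigma>\<close>. The boundary map on chains is the linear extension.\<close>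

definition simplex_boundary :: "nat set \<Rightarrow> (nat set \<Rightarrow>\<^sub>0 int)" where
  "simplex_boundary \<sigma> =
     (\<Sum>k = 1..card \<sigma>. frag_cmul ((- 1) ^ (k + 1)) (frag_of (\<sigma> - {sorted_list_of_set \<sigma> ! (k - 1)})))"

definition boundary_map :: "(nat set \<Rightarrow>\<^sub>0 int) \<Rightarrow> (nat set \<Rightarrow>\<^sub>0 int)" where
  "boundary_map = frag_extend simplex_boundary"

text \<open>The matrix of the top boundary map, with rows and columns indexed by finite types via
  enumerations of the ridges and of the facets.\<close>

definition boundary_matrix ::
    "('r::finite \<Rightarrow> nat set) \<Rightarrow> ('s::finite \<Rightarrow> nat set) \<Rightarrow> real^'s^'r" where
  "boundary_matrix ridge facet =
     (\<chi> i j. real_of_int (Poly_Mapping.lookup (boundary_map (frag_of (facet j))) (ridge i)))"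

definition symmetric_homology_polytope ::
    "('r::finite \<Rightarrow> nat set) \<Rightarrow> ('s::finite \<Rightarrow> nat set) \<Rightarrow> (real^'r) set" where
  "symmetric_homology_polytope ridge facet =
     convex hull (columns (boundary_matrix ridge facet) \<union> columns (- boundary_matrix ridge facet))"

definition real_image :: "real^'c::finite^'m::finite \<Rightarrow> (real^'m) set" where
  "real_image A = span (columns A)"

text \<open>The facet with index \<open>j\<close> is identified with the standard basis vector \<open>axis j 1\<close>.\<close>

definition labeling_vector :: "('s::finite \<Rightarrow> real) \<Rightarrow> real^'s" where
  "labeling_vector l = (\<Sum>j\<in>UNIV. l j *\<^sub>R axis j 1)"

definition face_labeling :: "real^'s::finite^'r::finite \<Rightarrow> ('s \<Rightarrow> real) \<Rightarrow> bool" where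
  "face_labeling A l \<longleftrightarrow>
     (\<forall>j. l j \<in> {-1..1}) \<and>
     labeling_vector l \<in> real_image (transpose A) \<and>
     Max (range (\<lambda>j. \<bar>l j\<bar>)) = 1"

definition supporting_hyperplane :: "'a::euclidean_space set \<Rightarrow> 'a set \<Rightarrow> bool" where
  "supporting_hyperplane H P \<longleftrightarrow>
     (\<exists>a b. a \<noteq> 0 \<and> H = {x. a \<bullet> x = b} \<and> P \<subseteq> {x. a \<bullet> x \<le> b} \<and> P \<inter> H \<noteq> {})"

end

theory Submission
  imports Defs
begin

text \<open>The entries of \<open>\<partial>\<^sub>d\<^sup>T w\<close> are the values \<open>w \<bullet> F\<^sub>j\<close>, so a labeling in the image of \<open>\<partial>\<^sub>d\<^sup>T\<close>
  records the values of a linear functional on the generators \<open>\<plusminus>F\<^sub>j\<close> of \<open>P\<close>, and the generators on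
  which the functional equals 1 are exactly the \<open>\<ell>\<^sub>i F\<^sub>i\<close> with \<open>\<bar>\<ell>\<^sub>i\<bar> = 1\<close>. Conversely, faces of
  polytopes are exposed, and by the symmetry \<open>P = -P\<close> the right-hand side of a functional exposing a
  proper face is positive and can be scaled to 1.\<close>

text \<open>A face of the hull of a compact set is the hull of some subset of the generators. That
  subset lies in the face, hence in the hyperplane, so it is contained in the set of generators with
  \<open>a \<bullet> v = b\<close>.\<close>

lemma convex_hull_Int_supporting_hyperplane:
  fixes S :: "'a::euclidean_space set"
  assumes "finite S" "\<And>v. v \<in> S \<Longrightarrow> a \<bullet> v \<le> b"
  shows "(convex hull S \<inter> {x. a \<bullet> x = b}) face_of (convex hull S)"
    and "convex hull S \<inter> {x. a \<bullet> x = b} = convex hull {v \<in> S. a \<bullet> v = b}"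
proof -
  have sub: "convex hull S \<subseteq> {x. a \<bullet> x \<le> b}"
    using assms(2) by (intro hull_minimal) (auto simp: convex_halfspace_le)
  then show face: "(convex hull S \<inter> {x. a \<bullet> x = b}) face_of (convex hull S)"
    by (intro face_of_Int_supporting_hyperplane_le) auto
  obtain S' where S': "S' \<subseteq> S" "convex hull S \<inter> {x. a \<bullet> x = b} = convex hull S'"
    using face_of_convex_hull_subset[OF finite_imp_compact[OF assms(1)] face] by blast
  have "S' \<subseteq> {v \<in> S. a \<bullet> v = b}"
    using S' hull_subset[of S' convex] by auto
  then have "convex hull S \<inter> {x. a \<bullet> x = b} \<subseteq> convex hull {v \<in> S. a \<bullet> v = b}"
    unfolding S'(2) by (rule hull_mono)
  moreover have "convex hull {v \<in> S. a \<bullet> v = b} \<subseteq> convex hull S"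
    by (rule hull_mono) auto
  moreover have "convex hull {v \<in> S. a \<bullet> v = b} \<subseteq> {x. a \<bullet> x = b}"
    by (rule hull_minimal) (auto simp: convex_hyperplane)
  ultimately show "convex hull S \<inter> {x. a \<bullet> x = b} = convex hull {v \<in> S. a \<bullet> v = b}"
    by blast
qed

lemma columns_Un_columns_uminus:
  fixes A :: "real^'s::finite^'r::finite"
  shows "columns A \<union> columns (- A) = (\<Union>i. {column i A, - column i A})"
proof -
  have "column i (- A) = - column i A" for i
    by (simp add: column_def vec_eq_iff)
  then show ?thesis
    by (auto simp: columns_def)
qed

lemma labeling_vector_nth: "labeling_vector l $ i = l i"
  by (simp add: labeling_vector_def axis_def if_distrib[of "\<lambda>x. _ * x"] cong: if_cong)

lemma transpose_mult_nth: "(transpose A *v w) $ i = (w::real^'r::finite) \<bullet> column i A"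
  by (simp add: matrix_vector_mult_def transpose_def inner_vec_def column_def mult.commute)

lemma transpose_mult_eq_labeling_vector_iff:
  "transpose A *v w = labeling_vector l \<longleftrightarrow> (\<forall>i. w \<bullet> column i A = l i)"
  unfolding vec_eq_iff labeling_vector_nth transpose_mult_nth ..

lemma span_columns_eq_range:
  fixes A :: "real^'n::finite^'m::finite"
  shows "span (columns A) = range ((*v) A)"
proof
  have "columns A \<subseteq> range ((*v) A)"
    unfolding columns_def using matrix_vector_mult_basis by (auto intro!: image_eqI[OF sym])
  moreover have "subspace (range ((*v) A))"
    by (rule linear_subspace_image) auto
  ultimately show "span (columns A) \<subseteq> range ((*v) A)"
    by (rule span_minimal)
  show "range ((*v) A) \<subseteq> span (columns A)"
    using matrix_vector_mult_in_columnspace by auto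
qed

text \<open>Membership in the span becomes solvability of a linear system, which supplies the
  functional \<open>w\<close>. The maximum splits into a pointwise bound and its attainment.\<close>

lemma face_labeling_iff:
  "face_labeling A l \<longleftrightarrow>
     (\<forall>j. \<bar>l j\<bar> \<le> 1) \<and> (\<exists>j. \<bar>l j\<bar> = 1) \<and> (\<exists>w. transpose A *v w = labeling_vector l)"
proof -
  have "labeling_vector l \<in> real_image (transpose A) \<longleftrightarrow>
      (\<exists>w. transpose A *v w = labeling_vector l)"
    unfolding real_image_def span_columns_eq_range image_iff
    by (simp only: bex_UNIV eq_commute[of "labeling_vector l"])
  moreover have "Max (range (\<lambda>j. \<bar>l j\<bar>)) = 1 \<longleftrightarrow> (\<exists>j. \<bar>l j\<bar> = 1) \<and> (\<forall>j. \<bar>l j\<bar> \<le> 1)"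
    by (subst Max_eq_iff) (simp_all add: image_iff eq_commute[of 1])
  moreover have "(\<forall>j. l j \<in> {-1..1}) \<longleftrightarrow> (\<forall>j. \<bar>l j\<bar> \<le> 1)"
    by (simp add: abs_le_iff minus_le_iff conj_commute)
  ultimately show ?thesis
    unfolding face_labeling_def by blast
qed

text \<open>For the boundary matrix \<open>A\<close>, the set \<open>P\<close> is the symmetric
  homology polytope and \<open>V\<close> its set of generators.\<close>

context
  fixes A :: "real^'s::finite^'r::finite" and V P :: "(real^'r) set"
  defines "V \<equiv> columns A \<union> columns (- A)"
    and "P \<equiv> convex hull V"
begin

lemma finite_signed_columns: "finite V"
  unfolding V_def columns_Un_columns_uminus by auto

text \<open>Each column occurs in \<open>V\<close> with both signs, so a one-sided bound on
  \<open>V\<close> is a two-sided bound on the columns.\<close>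

lemma inner_signed_columns_le_iff:
  "(\<forall>v\<in>V. w \<bullet> v \<le> b) \<longleftrightarrow> (\<forall>i. \<bar>w \<bullet> column i A\<bar> \<le> b)"
  unfolding V_def columns_Un_columns_uminus by (auto simp: abs_le_iff)

text \<open>A functional takes the value 1 on one of the two signed copies of a column iff its value
  on the column is 1 or -1, and multiplying by that value picks the right copy.\<close>

lemma signed_columns_on_hyperplane:
  "{v \<in> V. w \<bullet> v = 1} =
    {(w \<bullet> column i A) *\<^sub>R column i A | i. \<bar>w \<bullet> column i A\<bar> = 1}" (is "?L = ?R")
proof
  show "?L \<subseteq> ?R"
  proof
    fix v
    assume "v \<in> ?L"
    then obtain i where "v = column i A \<or> v = - column i A" "w \<bullet> v = 1"
      unfolding V_def columns_Un_columns_uminus by auto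
    then have "v = (w \<bullet> column i A) *\<^sub>R column i A \<and> \<bar>w \<bullet> column i A\<bar> = 1"
      by (auto simp: minus_equation_iff[of _ 1] eq_commute[of "- 1"])
    then show "v \<in> ?R" by blast
  qed
  show "?R \<subseteq> ?L"
    unfolding V_def columns_Un_columns_uminus by (auto simp: abs_if split: if_splits)
qed

text \<open>Phrased through the values of \<open>w\<close> on the columns, so that it serves both
  directions: these values are the labels.\<close>

lemma labeling_face:
  assumes "\<And>i. \<bar>w \<bullet> column i A\<bar> \<le> 1"
  shows "P \<subseteq> {x. w \<bullet> x \<le> 1}"
    and "(P \<inter> {x. w \<bullet> x = 1}) face_of P"
    and "P \<inter> {x. w \<bullet> x = 1} =
      convex hull {(w \<bullet> column i A) *\<^sub>R column i A | i. \<bar>w \<bullet> column i A\<bar> = 1}"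
proof -
  have le: "\<And>v. v \<in> V \<Longrightarrow> w \<bullet> v \<le> 1"
    using assms inner_signed_columns_le_iff by blast
  then show "P \<subseteq> {x. w \<bullet> x \<le> 1}"
    unfolding P_def by (intro hull_minimal) (auto simp: convex_halfspace_le)
  show "(P \<inter> {x. w \<bullet> x = 1}) face_of P"
    unfolding P_def by (rule convex_hull_Int_supporting_hyperplane(1)[OF finite_signed_columns le])
  show "P \<inter> {x. w \<bullet> x = 1} =
      convex hull {(w \<bullet> column i A) *\<^sub>R column i A | i. \<bar>w \<bullet> column i A\<bar> = 1}"
    using convex_hull_Int_supporting_hyperplane(2)[OF finite_signed_columns le]
    unfolding P_def signed_columns_on_hyperplane .
qed

lemma proper_face_exposed_at_1:
  assumes "G face_of P" "G \<noteq> {}" "G \<noteq> P"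
  obtains w where "P \<subseteq> {x. w \<bullet> x \<le> 1}" "G = P \<inter> {x. w \<bullet> x = 1}"
proof -
  have "polyhedron P"
    unfolding P_def by (simp add: finite_signed_columns polyhedron_convex_hull)
  then have "G exposed_face_of P"
    using assms(1) by (simp only: exposed_face_of_polyhedron)
  then obtain a b where ab: "P \<subseteq> {x. a \<bullet> x \<le> b}" "G = P \<inter> {x. a \<bullet> x = b}"
    unfolding exposed_face_of_def by (elim conjE exE)
  have le: "\<forall>i. \<bar>a \<bullet> column i A\<bar> \<le> b"
    using ab(1) hull_subset[of V convex]
    unfolding P_def inner_signed_columns_le_iff[symmetric] by blast
  then have "b \<ge> 0"
    by (meson abs_ge_zero order_trans)
  \<comment> \<open>If \<open>b = 0\<close>, the two-sided bound makes \<open>a\<close> vanish on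
    all generators, hence on \<open>P\<close>, and the face would be all of
    \<open>P\<close>.\<close>
  moreover have "b \<noteq> 0"
  proof
    assume "b = 0"
    then have "V \<subseteq> {x. a \<bullet> x = 0}"
      using le unfolding V_def columns_Un_columns_uminus by auto
    then have "P \<subseteq> {x. a \<bullet> x = 0}"
      unfolding P_def by (intro hull_minimal) (auto simp: convex_hyperplane)
    then show False
      using ab(2) \<open>b = 0\<close> assms(3) by auto
  qed
  ultimately have "b > 0" by simp
  with ab show ?thesis
    \<comment> \<open>Dividing by the positive \<open>b\<close> preserves both the inequality and
      the hyperplane.\<close>
    by (intro that[of "a /\<^sub>R b"]) (auto simp: field_simps)
qed

lemma face_of_labeling:
  assumes "face_labeling A l" "transpose A *v w = labeling_vector l"
  shows "supporting_hyperplane {x. w \<bullet> x = 1} P"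
    and "P \<subseteq> {x. w \<bullet> x \<le> 1}"
    and "(P \<inter> {x. w \<bullet> x = 1}) face_of P"
    and "P \<inter> {x. w \<bullet> x = 1} = convex hull {l i *\<^sub>R column i A | i. \<bar>l i\<bar> = 1}"
proof -
  have l: "w \<bullet> column i A = l i" for i
    using assms(2) unfolding transpose_mult_eq_labeling_vector_iff by blast
  have le: "\<bar>w \<bullet> column i A\<bar> \<le> 1" for i
    using assms(1) by (simp add: l face_labeling_iff)
  note face = labeling_face[OF le]
  show "P \<subseteq> {x. w \<bullet> x \<le> 1}" "(P \<inter> {x. w \<bullet> x = 1}) face_of P"
    by (fact face)+
  show eq: "P \<inter> {x. w \<bullet> x = 1} = convex hull {l i *\<^sub>R column i A | i. \<bar>l i\<bar> = 1}"
    using face(3) by (simp add: l)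
  \<comment> \<open>A label of absolute value 1 puts a generator on the hyperplane, so the face is
    nonempty; and \<open>w\<close> is nonzero because its product with column \<open>j\<close> is
    \<open>l j\<close>.\<close>
  obtain j where "\<bar>l j\<bar> = 1"
    using assms(1) by (auto simp: face_labeling_iff)
  then have "P \<inter> {x. w \<bullet> x = 1} \<noteq> {}" "w \<noteq> 0"
    unfolding eq using l[of j] by auto
  then show "supporting_hyperplane {x. w \<bullet> x = 1} P"
    unfolding supporting_hyperplane_def using face(1) by blast
qed

lemma labeling_of_face:
  assumes "G face_of P" "G \<noteq> {}" "G \<noteq> P"
  shows "\<exists>l. face_labeling A l \<and> G = convex hull {l i *\<^sub>R column i A | i. \<bar>l i\<bar> = 1}"
proof -
  obtain w where w: "P \<subseteq> {x. w \<bullet> x \<le> 1}" "G = P \<inter> {x. w \<bullet> x = 1}"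
    using proper_face_exposed_at_1[OF assms] .
  define l where "l i = w \<bullet> column i A" for i
  have "\<forall>i. \<bar>w \<bullet> column i A\<bar> \<le> 1"
    using w(1) hull_subset[of V convex]
    unfolding P_def inner_signed_columns_le_iff[symmetric] by blast
  then have le: "\<bar>w \<bullet> column i A\<bar> \<le> 1" for i
    by blast
  have G: "G = convex hull {l i *\<^sub>R column i A | i. \<bar>l i\<bar> = 1}"
    using labeling_face(3)[OF le] w(2) by (simp add: l_def)
  \<comment> \<open>Otherwise \<open>G\<close> would be the hull of the empty set. This is where
    nonemptiness of the face forces the maximum 1 to be attained.\<close>
  then have "\<exists>i. \<bar>l i\<bar> = 1"
    using assms(2) by auto
  moreover have "transpose A *v w = labeling_vector l"
    unfolding transpose_mult_eq_labeling_vector_iff by (simp add: l_def)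
  ultimately have "face_labeling A l"
    using le by (auto simp: face_labeling_iff l_def)
  with G show ?thesis by blast
qed

end

theorem theorem3p6:
  fixes n d :: nat
    and \<Delta> :: "nat set set"
    and facet :: "'s::finite \<Rightarrow> nat set"
    and ridge :: "'r::finite \<Rightarrow> nat set"
  defines "M \<equiv> boundary_matrix ridge facet"
    and "P \<equiv> symmetric_homology_polytope ridge facet"
  assumes "d \<ge> 1"
    and "abstract_simplicial_complex n \<Delta>"
    and "complex_dim \<Delta> = int d"
    and "pure_complex \<Delta>"
    and "bij_betw facet UNIV (complex_facets \<Delta>)"
    and "bij_betw ridge UNIV (faces_of_dim \<Delta> (int d - 1))"
  shows
    "(\<forall>l w. face_labeling M l \<and> transpose M *v w = labeling_vector l \<longrightarrow>
        supporting_hyperplane {x. w \<bullet> x = 1} P \<and>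
        P \<subseteq> {x. w \<bullet> x \<le> 1} \<and>
        (P \<inter> {x. w \<bullet> x = 1}) face_of P \<and>
        P \<inter> {x. w \<bullet> x = 1} = convex hull {l i *\<^sub>R column i M | i. \<bar>l i\<bar> = 1}) \<and>
     (\<forall>G. G face_of P \<and> G \<noteq> {} \<and> G \<noteq> P \<longrightarrow>
        (\<exists>l. face_labeling M l \<and>
           G = convex hull {l i *\<^sub>R column i M | i. \<bar>l i\<bar> = 1}))"
  unfolding M_def P_def symmetric_homology_polytope_def
  \<comment> \<open>Once unfolded, the polytope is literally the hull of the signed columns of the
    boundary matrix, so each goal is an instance of one of the two lemmas.\<close>
  by (intro conjI allI impI; elim conjE; rule face_of_labeling labeling_of_face; assumption)

end
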